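(* Let $\mathcal{F}$ be a nonempty family of finite loops such that: (1) if $L \in \mathcal{F}$ and $N$ is a normal subloop of $L$, then $N \in \mathcal{F}$; (2) if $L \in \mathcal{F}$ and $N$ is a normal subloop of $L$, then the factor loop $L/N$ belongs to $\mathcal{F}$; (3) every simple loop in $\mathcal{F}$ has the weak Lagrange property. Then every loop in $\mathcal{F}$ has the weak Lagrange property.
   Context: A loop is a set $L$ with a binary operation having a two-sided identity element $1$ such that for all $a,b\in L$ each of the equations $ax=b$ and $ya=b$ has a unique solution in $L$. A subloop of $L$ is a subset that is a loop under the restricted operation. A subloop $N$ of $L$ is normal if $xN=Nx$, $x(yN)=(xy)N$ and $(Nx)y=N(xy)$ for all $x,y\in L$ (equivalently, $N$ is the kernel of a loop homomorphism); then $L/N$ denotes the factor loop of cosets of $N$. A loop is simple if it has no normal subloops other than the trivial subloop and itself. A finite loop $L$ has the weak Lagrange property if, for every subloop $K$ of $L$, $|K|$ divides $|L|$. *)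

theory Defs
  imports "HOL-Algebra.Coset"
begin

locale loop =
  fixes L (structure)
  assumes m_closed: "\<lbrakk>a \<in> carrier L; b \<in> carrier L\<rbrakk> \<Longrightarrow> a \<otimes> b \<in> carrier L"
    and one_closed: "\<one> \<in> carrier L"
    and l_one: "a \<in> carrier L \<Longrightarrow> \<one> \<otimes> a = a"
    and r_one: "a \<in> carrier L \<Longrightarrow> a \<otimes> \<one> = a"
    and l_div: "\<lbrakk>a \<in> carrier L; b \<in> carrier L\<rbrakk> \<Longrightarrow> \<exists>!x. x \<in> carrier L \<and> a \<otimes> x = b"
    and r_div: "\<lbrakk>a \<in> carrier L; b \<in> carrier L\<rbrakk> \<Longrightarrow> \<exists>!y. y \<in> carrier L \<and> y \<otimes> a = b"

text \<open>
  Only the operation is restricted, so the identity of a subloop is not prescribed here;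
  \<open>subloop_iff\<close> shows that it can only be that of \<open>L\<close>.
\<close>
definition subloop :: "'a set \<Rightarrow> ('a, 'b) monoid_scheme \<Rightarrow> bool" where
  "subloop H L \<longleftrightarrow> H \<subseteq> carrier L \<and> (\<exists>e. loop (L\<lparr>carrier := H, one := e\<rparr>))"

lemma subloop_iff:
  assumes "loop L"
  shows "subloop H L \<longleftrightarrow> H \<subseteq> carrier L \<and> loop (L\<lparr>carrier := H\<rparr>)"
proof
  assume "subloop H L"
  then obtain e where H: "H \<subseteq> carrier L" and e: "loop (L\<lparr>carrier := H, one := e\<rparr>)"
    by (auto simp: subloop_def)
  have "e \<in> H" "e \<otimes>\<^bsub>L\<^esub> e = e"
    using loop.one_closed[OF e] loop.l_one[OF e, of e] by auto
  moreover have "e \<otimes>\<^bsub>L\<^esub> \<one>\<^bsub>L\<^esub> = e"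
    using loop.r_one[OF assms] H \<open>e \<in> H\<close> by auto
  ultimately have "e = \<one>\<^bsub>L\<^esub>"
    using loop.l_div[OF assms, of e e] loop.one_closed[OF assms] H by auto
  then show "H \<subseteq> carrier L \<and> loop (L\<lparr>carrier := H\<rparr>)"
    using H e by simp
next
  assume "H \<subseteq> carrier L \<and> loop (L\<lparr>carrier := H\<rparr>)"
  moreover have "L\<lparr>carrier := H, one := \<one>\<^bsub>L\<^esub>\<rparr> = L\<lparr>carrier := H\<rparr>"
    by simp
  ultimately show "subloop H L"
    unfolding subloop_def by metis
qed

definition normal_subloop :: "'a set \<Rightarrow> ('a, 'b) monoid_scheme \<Rightarrow> bool" where
  "normal_subloop N L \<longleftrightarrow> subloop N L \<and>
    (\<forall>x\<in>carrier L. x <#\<^bsub>L\<^esub> N = N #>\<^bsub>L\<^esub> x) \<and>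
    (\<forall>x\<in>carrier L. \<forall>y\<in>carrier L. x <#\<^bsub>L\<^esub> (y <#\<^bsub>L\<^esub> N) = (x \<otimes>\<^bsub>L\<^esub> y) <#\<^bsub>L\<^esub> N) \<and>
    (\<forall>x\<in>carrier L. \<forall>y\<in>carrier L. (N #>\<^bsub>L\<^esub> x) #>\<^bsub>L\<^esub> y = N #>\<^bsub>L\<^esub> (x \<otimes>\<^bsub>L\<^esub> y))"

text \<open>
  The factor loop is \<open>L Mod N\<close>. The library defines \<open>Mod\<close> with groups in mind, as the set of
  cosets under the elementwise product; the next lemma shows that for a normal subloop this is
  the usual multiplication of cosets.
\<close>
lemma rcos_mult:
  assumes "loop L" "normal_subloop N L" "x \<in> carrier L" "y \<in> carrier L"
  shows "(N #>\<^bsub>L\<^esub> x) <#>\<^bsub>L\<^esub> (N #>\<^bsub>L\<^esub> y) = N #>\<^bsub>L\<^esub> (x \<otimes>\<^bsub>L\<^esub> y)"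
proof -
  interpret loop L by fact
  note N = assms(2)[unfolded normal_subloop_def subloop_iff[OF assms(1)]]
  have sub: "N \<subseteq> carrier L" and lp: "loop (L\<lparr>carrier := N\<rparr>)"
    using N by auto
  have xy: "x \<otimes>\<^bsub>L\<^esub> y \<in> carrier L"
    using assms m_closed by auto
  have NN: "N #>\<^bsub>L\<^esub> n = N" if n: "n \<in> N" for n
  proof
    show "N #>\<^bsub>L\<^esub> n \<subseteq> N"
      using loop.m_closed[OF lp] n by (auto simp: r_coset_def)
    show "N \<subseteq> N #>\<^bsub>L\<^esub> n"
    proof
      fix m assume "m \<in> N"
      then obtain k where "k \<in> N" "k \<otimes>\<^bsub>L\<^esub> n = m"
        using loop.r_div[OF lp, of n m] n by auto
      then show "m \<in> N #>\<^bsub>L\<^esub> n"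
        by (auto simp: r_coset_def)
    qed
  qed
  have "(N #>\<^bsub>L\<^esub> x) <#>\<^bsub>L\<^esub> (N #>\<^bsub>L\<^esub> y) = (\<Union>u\<in>N #>\<^bsub>L\<^esub> x. u <#\<^bsub>L\<^esub> (y <#\<^bsub>L\<^esub> N))"
    using N assms by (auto simp: set_mult_def l_coset_def)
  also have "\<dots> = (\<Union>u\<in>N #>\<^bsub>L\<^esub> x. N #>\<^bsub>L\<^esub> (u \<otimes>\<^bsub>L\<^esub> y))"
  proof (rule SUP_cong[OF refl])
    fix u assume "u \<in> N #>\<^bsub>L\<^esub> x"
    then have u: "u \<in> carrier L"
      using sub assms m_closed by (auto simp: r_coset_def)
    show "u <#\<^bsub>L\<^esub> (y <#\<^bsub>L\<^esub> N) = N #>\<^bsub>L\<^esub> (u \<otimes>\<^bsub>L\<^esub> y)"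
      using N u assms(4) m_closed[OF u assms(4)] by metis
  qed
  also have "\<dots> = (\<Union>w\<in>(N #>\<^bsub>L\<^esub> x) #>\<^bsub>L\<^esub> y. N #>\<^bsub>L\<^esub> w)"
    by (auto simp: r_coset_def)
  also have "\<dots> = (\<Union>w\<in>N #>\<^bsub>L\<^esub> (x \<otimes>\<^bsub>L\<^esub> y). N #>\<^bsub>L\<^esub> w)"
    using N assms by simp
  also have "\<dots> = (\<Union>n\<in>N. (N #>\<^bsub>L\<^esub> n) #>\<^bsub>L\<^esub> (x \<otimes>\<^bsub>L\<^esub> y))"
  proof -
    have "(N #>\<^bsub>L\<^esub> n) #>\<^bsub>L\<^esub> (x \<otimes>\<^bsub>L\<^esub> y) = N #>\<^bsub>L\<^esub> (n \<otimes>\<^bsub>L\<^esub> (x \<otimes>\<^bsub>L\<^esub> y))" if "n \<in> N" for n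
      using N xy that by auto
    then show ?thesis
      by (auto simp: r_coset_def)
  qed
  also have "\<dots> = N #>\<^bsub>L\<^esub> (x \<otimes>\<^bsub>L\<^esub> y)"
    using NN loop.one_closed[OF lp] by auto
  finally show ?thesis .
qed

definition simple_loop :: "('a, 'b) monoid_scheme \<Rightarrow> bool" where
  "simple_loop L \<longleftrightarrow> loop L \<and>
    (\<forall>N. normal_subloop N L \<longrightarrow> N = {\<one>\<^bsub>L\<^esub>} \<or> N = carrier L)"

definition weak_lagrange :: "('a, 'b) monoid_scheme \<Rightarrow> bool" where
  "weak_lagrange L \<longleftrightarrow> (\<forall>K. subloop K L \<longrightarrow> card K dvd order L)"

text \<open>
  For loops \<open>L\<close> over \<open>'a\<close> the factor loop \<open>L Mod N\<close> lives over \<open>'a set\<close>, so it cannot literally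
  be an element of a set \<open>F\<close> of loops over \<open>'a\<close>. Membership in a family is therefore read up to
  isomorphism. This is the reading under which the values of the operation off the carrier
  are irrelevant as well.
\<close>
definition belongs_to :: "('a, 'b) monoid_scheme \<Rightarrow> ('c, 'd) monoid_scheme set \<Rightarrow> bool" where
  "belongs_to L F \<longleftrightarrow> (\<exists>M\<in>F. L \<cong> M)"

end

theory Submission
  imports Defs
begin

text \<open>
  Weak Lagrange is preserved by extensions: if a finite loop \<open>L\<close> has a normal subloop \<open>N\<close> such
  that \<open>N\<close> and \<open>L/N\<close> both have the weak Lagrange property, then so does \<open>L\<close>. Indeed, for a
  subloop \<open>K\<close> the map \<open>k \<mapsto> N k\<close> sends \<open>K\<close> onto a subloop \<open>KN/N\<close> of \<open>L/N\<close>. Its fibre through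
  \<open>k\<close> is the translate \<open>(N \<inter> K) k\<close>, because \<open>n k \<in> K\<close> forces \<open>n \<in> K\<close> by right division in \<open>K\<close>.
  So all fibres have the same size, although the cosets of an arbitrary subloop of \<open>L\<close> need not
  partition \<open>L\<close>, and \<open>|K| = |N \<inter> K| |KN/N|\<close> (\<open>card_eq_card_inter_mult_card_cosets\<close>).
  The first factor divides \<open>|N|\<close>, the second divides \<open>|L/N|\<close>, and \<open>|N| |L/N| = |L|\<close> is the same
  formula for \<open>K = L\<close> (\<open>weak_lagrange_extension\<close>).

  The theorem follows by induction on \<open>|L|\<close>. A loop that is not simple has a normal subloop \<open>N\<close>
  other than \<open>1\<close> and \<open>L\<close>, so \<open>N\<close> and \<open>L/N\<close> are both smaller than \<open>L\<close>. Since they belong to the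
  family only up to isomorphism, the induction hypothesis reaches them through the
  invariance \<open>weak_lagrange_iso\<close>.
\<close>

lemma (in loop) l_cancel:
  assumes "a \<in> carrier L" "x \<in> carrier L" "y \<in> carrier L" "a \<otimes> x = a \<otimes> y"
  shows "x = y"
  using l_div[of a "a \<otimes> y"] assms m_closed by metis

lemma (in loop) r_cancel:
  assumes "a \<in> carrier L" "x \<in> carrier L" "y \<in> carrier L" "x \<otimes> a = y \<otimes> a"
  shows "x = y"
  using r_div[of a "y \<otimes> a"] assms m_closed by metis

text \<open>
  The identity of the image is prescribed because \<open>iso\<close> only asks for compatibility with the
  products.
\<close>
lemma loop_iso_image:
  assumes "loop A" and h: "h \<in> iso A B" and one: "\<one>\<^bsub>B\<^esub> = h \<one>\<^bsub>A\<^esub>"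
  shows "loop B"
proof -
  interpret A: loop A by fact
  have bij: "bij_betw h (carrier A) (carrier B)"
    and mult: "\<And>x y. x \<in> carrier A \<Longrightarrow> y \<in> carrier A \<Longrightarrow> h (x \<otimes>\<^bsub>A\<^esub> y) = h x \<otimes>\<^bsub>B\<^esub> h y"
    using h by (auto simp: iso_def hom_def)
  have carr: "carrier B = h ` carrier A" and inj: "inj_on h (carrier A)"
    using bij by (auto simp: bij_betw_def)
  show ?thesis
  proof
    fix a b assume "a \<in> carrier B" "b \<in> carrier B"
    then obtain a' b' where ab: "a' \<in> carrier A" "a = h a'" "b' \<in> carrier A" "b = h b'"
      unfolding carr by auto
    show "a \<otimes>\<^bsub>B\<^esub> b \<in> carrier B"
      using ab A.m_closed mult unfolding carr by (metis imageI)
    obtain x where x: "x \<in> carrier A" "a' \<otimes>\<^bsub>A\<^esub> x = b'" using A.l_div ab by blast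
    show "\<exists>!x. x \<in> carrier B \<and> a \<otimes>\<^bsub>B\<^esub> x = b"
    proof (rule ex1I[of _ "h x"])
      show "h x \<in> carrier B \<and> a \<otimes>\<^bsub>B\<^esub> h x = b" using x ab mult carr by auto
      fix y assume "y \<in> carrier B \<and> a \<otimes>\<^bsub>B\<^esub> y = b"
      then obtain y' where y: "y' \<in> carrier A" "y = h y'" "h (a' \<otimes>\<^bsub>A\<^esub> y') = h b'"
        using ab mult carr by auto
      then have "a' \<otimes>\<^bsub>A\<^esub> y' = b'" using inj ab A.m_closed by (meson inj_onD)
      then show "y = h x" using A.l_cancel[of a' x y'] x y ab by auto
    qed
    obtain x where x: "x \<in> carrier A" "x \<otimes>\<^bsub>A\<^esub> a' = b'" using A.r_div ab by blast
    show "\<exists>!x. x \<in> carrier B \<and> x \<otimes>\<^bsub>B\<^esub> a = b"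
    proof (rule ex1I[of _ "h x"])
      show "h x \<in> carrier B \<and> h x \<otimes>\<^bsub>B\<^esub> a = b" using x ab mult carr by auto
      fix y assume "y \<in> carrier B \<and> y \<otimes>\<^bsub>B\<^esub> a = b"
      then obtain y' where y: "y' \<in> carrier A" "y = h y'" "h (y' \<otimes>\<^bsub>A\<^esub> a') = h b'"
        using ab mult carr by auto
      then have "y' \<otimes>\<^bsub>A\<^esub> a' = b'" using inj ab A.m_closed by (meson inj_onD)
      then show "y = h x" using A.r_cancel[of a' x y'] x y ab by auto
    qed
  next
    show "\<one>\<^bsub>B\<^esub> \<in> carrier B" using one carr A.one_closed by auto
  next
    fix a assume "a \<in> carrier B"
    then obtain a' where a: "a' \<in> carrier A" "a = h a'" unfolding carr by auto
    show "\<one>\<^bsub>B\<^esub> \<otimes>\<^bsub>B\<^esub> a = a" "a \<otimes>\<^bsub>B\<^esub> \<one>\<^bsub>B\<^esub> = a"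
      using a A.one_closed A.l_one A.r_one mult one by metis+
  qed
qed

lemma weak_lagrange_iso:
  assumes "A \<cong> B" and B: "weak_lagrange B"
  shows "weak_lagrange A"
  unfolding weak_lagrange_def
proof (intro allI impI)
  fix K assume "subloop K A"
  then obtain e where K: "K \<subseteq> carrier A" and lp: "loop (A\<lparr>carrier := K, one := e\<rparr>)"
    by (auto simp: subloop_def)
  obtain h where h: "h \<in> hom A B" "bij_betw h (carrier A) (carrier B)"
    using assms(1) by (auto simp: is_iso_def iso_def)
  have inj: "inj_on h K" using h K by (meson bij_betw_def inj_on_subset)
  have "h \<in> iso (A\<lparr>carrier := K, one := e\<rparr>) (B\<lparr>carrier := h ` K, one := h e\<rparr>)"
    using h(1) K inj by (auto simp: iso_def hom_def bij_betw_def subset_eq)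
  then have "loop (B\<lparr>carrier := h ` K, one := h e\<rparr>)"
    by (rule loop_iso_image[OF lp]) simp
  moreover have "h ` K \<subseteq> carrier B" using h K by (auto simp: bij_betw_def)
  ultimately have "card (h ` K) dvd order B"
    using B unfolding weak_lagrange_def subloop_def by blast
  then show "card K dvd order A"
    using card_image[OF inj] bij_betw_same_card[OF h(2)] by (simp add: order_def)
qed

lemma weak_lagrange_if_belongs_to:
  assumes "belongs_to A F"
    and "\<And>M. M \<in> F \<Longrightarrow> order M = order A \<Longrightarrow> weak_lagrange M"
  shows "weak_lagrange A"
proof -
  obtain M where M: "M \<in> F" "A \<cong> M" using assms(1) by (auto simp: belongs_to_def)
  then have "order M = order A" using iso_same_card[OF M(2)] by (simp add: order_def)
  then show ?thesis using assms(2) M weak_lagrange_iso by blast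
qed

lemma (in loop) subloopD:
  assumes "subloop H L"
  shows "H \<subseteq> carrier L" "\<one> \<in> H"
    and "\<And>a b. a \<in> H \<Longrightarrow> b \<in> H \<Longrightarrow> a \<otimes> b \<in> H"
    and "\<And>a b. a \<in> H \<Longrightarrow> b \<in> H \<Longrightarrow> \<exists>x\<in>H. a \<otimes> x = b"
    and "\<And>a b. a \<in> H \<Longrightarrow> b \<in> H \<Longrightarrow> \<exists>x\<in>H. x \<otimes> a = b"
proof -
  have sub: "H \<subseteq> carrier L" and lp: "loop (L\<lparr>carrier := H\<rparr>)"
    using assms subloop_iff[OF loop_axioms] by auto
  show "H \<subseteq> carrier L" by (fact sub)
  show "\<one> \<in> H" using loop.one_closed[OF lp] by simp
  fix a b assume "a \<in> H" "b \<in> H"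
  then show "a \<otimes> b \<in> H" "\<exists>x\<in>H. a \<otimes> x = b" "\<exists>x\<in>H. x \<otimes> a = b"
    using loop.m_closed[OF lp, of a b] loop.l_div[OF lp, of a b] loop.r_div[OF lp, of a b]
    by auto
qed

lemma (in loop) subloop_division_closed:
  assumes "subloop H L" "a \<in> H" "x \<in> carrier L"
  shows "a \<otimes> x \<in> H \<Longrightarrow> x \<in> H" "x \<otimes> a \<in> H \<Longrightarrow> x \<in> H"
  using subloopD[OF assms(1)] assms(2,3) l_cancel[of a] r_cancel[of a]
  by (metis subsetD)+

lemma (in loop) subloop_inter:
  assumes H: "subloop H L" and K: "subloop K L"
  shows "subloop (H \<inter> K) (L\<lparr>carrier := H\<rparr>)"
proof -
  note HD = subloopD[OF H] and KD = subloopD[OF K]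
  have "loop (L\<lparr>carrier := H \<inter> K, one := \<one>\<rparr>)"
  proof
    fix a b
    assume "a \<in> carrier (L\<lparr>carrier := H \<inter> K, one := \<one>\<rparr>)"
      and "b \<in> carrier (L\<lparr>carrier := H \<inter> K, one := \<one>\<rparr>)"
    then have ab: "a \<in> H" "a \<in> K" "b \<in> H" "b \<in> K" by auto
    obtain x where "x \<in> H" "a \<otimes> x = b" using HD(4) ab by blast
    then have x: "x \<in> H \<inter> K" "a \<otimes> x = b"
      using subloop_division_closed(1)[OF K, of a x] ab HD(1) by auto
    obtain y where "y \<in> H" "y \<otimes> a = b" using HD(5) ab by blast
    then have y: "y \<in> H \<inter> K" "y \<otimes> a = b"
      using subloop_division_closed(2)[OF K, of a y] ab HD(1) by auto
    show "\<exists>!x. x \<in> carrier (L\<lparr>carrier := H \<inter> K, one := \<one>\<rparr>)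
        \<and> a \<otimes>\<^bsub>L\<lparr>carrier := H \<inter> K, one := \<one>\<rparr>\<^esub> x = b"
      using x ab HD(1) l_cancel[of a] by (intro ex1I[of _ x]) auto
    show "\<exists>!x. x \<in> carrier (L\<lparr>carrier := H \<inter> K, one := \<one>\<rparr>)
        \<and> x \<otimes>\<^bsub>L\<lparr>carrier := H \<inter> K, one := \<one>\<rparr>\<^esub> a = b"
      using y ab HD(1) r_cancel[of a] by (intro ex1I[of _ y]) auto
  qed (use HD KD l_one r_one in auto)
  moreover have "H \<inter> K \<subseteq> carrier (L\<lparr>carrier := H\<rparr>)" by simp
  moreover have "L\<lparr>carrier := H \<inter> K, one := \<one>\<rparr> = L\<lparr>carrier := H, carrier := H \<inter> K, one := \<one>\<rparr>"
    by simp
  ultimately show ?thesis unfolding subloop_def by metis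
qed

lemma (in loop) subloop_carrier: "subloop (carrier L) L"
  using loop_axioms by (simp add: subloop_iff)

lemma (in loop) rcos_const:
  assumes N: "subloop N L" and n: "n \<in> N"
  shows "N #> n = N"
  using subloopD(3,5)[OF N] n unfolding r_coset_def by blast

lemma (in loop) rcos_self:
  assumes "subloop N L" "x \<in> carrier L"
  shows "x \<in> N #> x"
  using subloopD(2)[OF assms(1)] l_one[OF assms(2)] unfolding r_coset_def by force

text \<open>
  Cancellation of cosets is cancellation in \<open>L\<close> applied to whole subsets: by normality,
  \<open>N(ax) = a(xN)\<close> and \<open>N(xa) = (Nx)a\<close>, and translations of \<open>L\<close> are injective.
\<close>
lemma (in loop) rcos_cancel:
  assumes N: "normal_subloop N L"
    and a: "a \<in> carrier L" and x: "x \<in> carrier L" and y: "y \<in> carrier L"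
  shows "N #> (a \<otimes> x) = N #> (a \<otimes> y) \<Longrightarrow> N #> x = N #> y"
    and "N #> (x \<otimes> a) = N #> (y \<otimes> a) \<Longrightarrow> N #> x = N #> y"
proof -
  have sub: "N \<subseteq> carrier L" using N subloopD(1) by (auto simp: normal_subloop_def)
  have carr: "N #> z \<subseteq> carrier L" if "z \<in> carrier L" for z
    using sub that m_closed by (auto simp: r_coset_def)
  have l: "N #> (a \<otimes> z) = (\<lambda>u. a \<otimes> u) ` (N #> z)" if z: "z \<in> carrier L" for z
  proof -
    have "N #> (a \<otimes> z) = a <# (z <# N)"
      using N a z m_closed by (auto simp: normal_subloop_def)
    also have "\<dots> = a <# (N #> z)" using N z by (auto simp: normal_subloop_def)
    finally show ?thesis by (auto simp: l_coset_def)
  qed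
  have r: "N #> (z \<otimes> a) = (\<lambda>u. u \<otimes> a) ` (N #> z)" if z: "z \<in> carrier L" for z
  proof -
    have "N #> (z \<otimes> a) = (N #> z) #> a" using N a z by (auto simp: normal_subloop_def)
    then show ?thesis by (auto simp: r_coset_def)
  qed
  have "inj_on (\<lambda>u. a \<otimes> u) (carrier L)" "inj_on (\<lambda>u. u \<otimes> a) (carrier L)"
    using l_cancel[OF a] r_cancel[OF a] by (auto intro: inj_onI)
  then show "N #> (a \<otimes> x) = N #> (a \<otimes> y) \<Longrightarrow> N #> x = N #> y"
    and "N #> (x \<otimes> a) = N #> (y \<otimes> a) \<Longrightarrow> N #> x = N #> y"
    using l[OF x] l[OF y] r[OF x] r[OF y] carr[OF x] carr[OF y]
    by (simp_all add: inj_on_image_eq_iff)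
qed

text \<open>
  The quotients that witness division in \<open>KN/N\<close> come from dividing representatives inside \<open>K\<close>;
  their uniqueness is the cancellation of cosets.
\<close>
lemma (in loop) subloop_cosets:
  assumes N: "normal_subloop N L" and K: "subloop K L"
  shows "subloop ((\<lambda>k. N #> k) ` K) (L Mod N)"
proof -
  note KD = subloopD[OF K]
  have sN: "subloop N L" using N by (simp add: normal_subloop_def)
  have mult: "(N #> x) <#> (N #> y) = N #> (x \<otimes> y)" if "x \<in> K" "y \<in> K" for x y
    using rcos_mult[OF loop_axioms N] that KD(1) by auto
  have one: "N #> \<one> = N" using rcos_const[OF sN subloopD(2)[OF sN]] .
  let ?Q = "(L Mod N)\<lparr>carrier := (\<lambda>k. N #> k) ` K, one := N\<rparr>"
  have carrQ: "carrier ?Q = (\<lambda>k. N #> k) ` K" and multQ: "\<And>X Y. X \<otimes>\<^bsub>?Q\<^esub> Y = X <#> Y"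
    and oneQ: "\<one>\<^bsub>?Q\<^esub> = N #> \<one>"
    using one by (auto simp: FactGroup_def)
  have "loop ?Q"
  proof
    fix A B assume "A \<in> carrier ?Q" "B \<in> carrier ?Q"
    then obtain a b where ab: "a \<in> K" "A = N #> a" "b \<in> K" "B = N #> b"
      unfolding carrQ by auto
    show "A \<otimes>\<^bsub>?Q\<^esub> B \<in> carrier ?Q" unfolding multQ carrQ using ab mult KD(3) by auto
    obtain x where x: "x \<in> K" "a \<otimes> x = b" using KD(4) ab by blast
    show "\<exists>!X. X \<in> carrier ?Q \<and> A \<otimes>\<^bsub>?Q\<^esub> X = B"
      unfolding multQ carrQ
    proof (rule ex1I[of _ "N #> x"])
      show "N #> x \<in> (\<lambda>k. N #> k) ` K \<and> A <#> (N #> x) = B" using x ab mult by auto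
      fix Y assume "Y \<in> (\<lambda>k. N #> k) ` K \<and> A <#> Y = B"
      then obtain y where "y \<in> K" "Y = N #> y" "N #> (a \<otimes> y) = N #> (a \<otimes> x)"
        using ab x mult by auto
      then show "Y = N #> x" using rcos_cancel(1)[OF N, of a y x] ab x KD(1) by auto
    qed
    obtain x where x: "x \<in> K" "x \<otimes> a = b" using KD(5) ab by blast
    show "\<exists>!X. X \<in> carrier ?Q \<and> X \<otimes>\<^bsub>?Q\<^esub> A = B"
      unfolding multQ carrQ
    proof (rule ex1I[of _ "N #> x"])
      show "N #> x \<in> (\<lambda>k. N #> k) ` K \<and> (N #> x) <#> A = B" using x ab mult by auto
      fix Y assume "Y \<in> (\<lambda>k. N #> k) ` K \<and> Y <#> A = B"
      then obtain y where "y \<in> K" "Y = N #> y" "N #> (y \<otimes> a) = N #> (x \<otimes> a)"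
        using ab x mult by auto
      then show "Y = N #> x" using rcos_cancel(2)[OF N, of a y x] ab x KD(1) by auto
    qed
  next
    show "\<one>\<^bsub>?Q\<^esub> \<in> carrier ?Q" unfolding oneQ carrQ using KD(2) by auto
  next
    fix A assume "A \<in> carrier ?Q"
    then obtain a where a: "a \<in> K" "A = N #> a" unfolding carrQ by auto
    show "\<one>\<^bsub>?Q\<^esub> \<otimes>\<^bsub>?Q\<^esub> A = A" "A \<otimes>\<^bsub>?Q\<^esub> \<one>\<^bsub>?Q\<^esub> = A"
      unfolding multQ oneQ using a mult KD(1,2) l_one r_one by auto
  qed
  moreover have "(\<lambda>k. N #> k) ` K \<subseteq> carrier (L Mod N)"
    using KD(1) by (auto simp: FactGroup_def RCOSETS_def)
  ultimately show ?thesis unfolding subloop_def by blast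
qed

text \<open>
  This replaces Lagrange's theorem: \<open>K\<close> splits into the fibres of \<open>k \<mapsto> N k\<close>, and right
  multiplication by \<open>k\<close> is a bijection from \<open>N \<inter> K\<close> to the fibre through \<open>k\<close>.
\<close>
lemma (in loop) card_eq_card_inter_mult_card_cosets:
  assumes fin: "finite (carrier L)" and N: "normal_subloop N L" and K: "subloop K L"
  shows "card K = card (N \<inter> K) * card ((\<lambda>k. N #> k) ` K)"
proof -
  note KD = subloopD[OF K]
  have sN: "subloop N L" using N by (simp add: normal_subloop_def)
  note ND = subloopD[OF sN]
  have finK: "finite K" using KD(1) fin finite_subset by blast
  have fibre: "card {x \<in> K. N #> x = N #> k} = card (N \<inter> K)" if k: "k \<in> K" for k
  proof -
    have kL: "k \<in> carrier L" using k KD(1) by auto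
    have "{x \<in> K. N #> x = N #> k} = (\<lambda>n. n \<otimes> k) ` (N \<inter> K)"
    proof (intro equalityI subsetI)
      fix x assume x: "x \<in> {x \<in> K. N #> x = N #> k}"
      then have "x \<in> N #> k" using rcos_self[OF sN] KD(1) by blast
      then obtain n where n: "n \<in> N" "x = n \<otimes> k" by (auto simp: r_coset_def)
      then have "n \<in> K"
        using subloop_division_closed(2)[OF K k, of n] ND(1) x by auto
      then show "x \<in> (\<lambda>n. n \<otimes> k) ` (N \<inter> K)" using n by auto
    next
      fix x assume "x \<in> (\<lambda>n. n \<otimes> k) ` (N \<inter> K)"
      then obtain n where n: "n \<in> N" "n \<in> K" "x = n \<otimes> k" by auto
      have "N #> x = (N #> n) #> k"
        using N n ND(1) kL by (auto simp: normal_subloop_def)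
      then show "x \<in> {x \<in> K. N #> x = N #> k}"
        using n k KD(3) rcos_const[OF sN] by auto
    qed
    moreover have "inj_on (\<lambda>n. n \<otimes> k) (N \<inter> K)"
      using r_cancel[OF kL] KD(1) by (auto intro!: inj_onI)
    ultimately show ?thesis by (simp add: card_image)
  qed
  have "card K = (\<Sum>C\<in>(\<lambda>k. N #> k) ` K. card {x \<in> K. N #> x = C})"
    using sum.image_gen[OF finK, of "\<lambda>_. 1::nat" "\<lambda>k. N #> k"] by simp
  also have "\<dots> = (\<Sum>C\<in>(\<lambda>k. N #> k) ` K. card (N \<inter> K))"
    by (rule sum.cong) (auto simp: fibre)
  finally show ?thesis by simp
qed

lemma (in loop) order_eq_card_normal_mult_order_factor:
  assumes "finite (carrier L)" and N: "normal_subloop N L"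
  shows "order L = card N * order (L Mod N)"
proof -
  have "N \<inter> carrier L = N"
    using N subloopD(1) by (auto simp: normal_subloop_def)
  moreover have "carrier (L Mod N) = (\<lambda>k. N #> k) ` carrier L"
    by (auto simp: FactGroup_def RCOSETS_def)
  ultimately show ?thesis
    using card_eq_card_inter_mult_card_cosets[OF assms subloop_carrier]
    by (simp add: order_def)
qed

lemma (in loop) weak_lagrange_extension:
  assumes fin: "finite (carrier L)" and N: "normal_subloop N L"
    and wN: "weak_lagrange (L\<lparr>carrier := N\<rparr>)" and wQ: "weak_lagrange (L Mod N)"
  shows "weak_lagrange L"
  unfolding weak_lagrange_def
proof (intro allI impI)
  fix K assume K: "subloop K L"
  have "subloop N L" using N by (simp add: normal_subloop_def)
  then have "card (N \<inter> K) dvd card N"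
    using wN subloop_inter[OF _ K] by (auto simp: weak_lagrange_def order_def)
  moreover have "card ((\<lambda>k. N #> k) ` K) dvd order (L Mod N)"
    using wQ subloop_cosets[OF N K] by (auto simp: weak_lagrange_def)
  ultimately show "card K dvd order L"
    unfolding card_eq_card_inter_mult_card_cosets[OF fin N K]
      order_eq_card_normal_mult_order_factor[OF fin N]
    by (rule mult_dvd_mono)
qed

theorem theorem1:
  fixes F :: "'a monoid set"
  assumes nonempty: "F \<noteq> {}"
    and finite_loops: "\<And>L. L \<in> F \<Longrightarrow> loop L \<and> finite (carrier L)"
    and normal_closed: "\<And>L N. L \<in> F \<Longrightarrow> normal_subloop N L \<Longrightarrow> belongs_to (L\<lparr>carrier := N\<rparr>) F"
    and factor_closed: "\<And>L N. L \<in> F \<Longrightarrow> normal_subloop N L \<Longrightarrow> belongs_to (L Mod N) F"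
    and simple_weak_lagrange: "\<And>L. L \<in> F \<Longrightarrow> simple_loop L \<Longrightarrow> weak_lagrange L"
  shows "\<forall>L\<in>F. weak_lagrange L"
proof
  fix L assume "L \<in> F"
  then show "weak_lagrange L"
  proof (induction "order L" arbitrary: L rule: less_induct)
    case less
    interpret loop L using finite_loops less.prems by blast
    have fin: "finite (carrier L)" using finite_loops less.prems by blast
    show ?case
    proof (cases "simple_loop L")
      case True
      then show ?thesis using simple_weak_lagrange less.prems by blast
    next
      case False
      then obtain N where N: "normal_subloop N L" "N \<noteq> {\<one>\<^bsub>L\<^esub>}" "N \<noteq> carrier L"
        using loop_axioms by (auto simp: simple_loop_def)
      have sN: "subloop N L" using N by (simp add: normal_subloop_def)
      note ND = subloopD[OF sN]
      have less_N: "card N < order L"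
        using N(3) ND(1) fin by (auto simp: order_def intro: psubset_card_mono)
      have "{\<one>\<^bsub>L\<^esub>} \<subset> N" using N(2) ND(2) by auto
      then have "card N > 1"
        using psubset_card_mono[of N "{\<one>\<^bsub>L\<^esub>}"] ND(1) fin finite_subset by auto
      moreover have "order L > 0"
        using less_N by simp
      ultimately have less_Q: "order (L Mod N) < order L"
        unfolding order_eq_card_normal_mult_order_factor[OF fin N(1)] by simp
      have "weak_lagrange (L\<lparr>carrier := N\<rparr>)"
        using weak_lagrange_if_belongs_to[OF normal_closed[OF less.prems N(1)]] less.hyps less_N
        by (simp add: order_def)
      moreover have "weak_lagrange (L Mod N)"
        using weak_lagrange_if_belongs_to[OF factor_closed[OF less.prems N(1)]] less.hyps less_Q
        by simp
      ultimately show ?thesis using weak_lagrange_extension[OF fin N(1)] by blast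
    qed
  qed
qed

end
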